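(* Let $T>0$, and let $b,G,\sigma,\Sigma=\sigma\sigma^{\rm T},R,c,f$ be as in the context. Let $\alpha_t:\mathbb{R}^{d_x}\to\mathbb{R}$, $t\in[0,T]$, be a (possibly time-dependent) convex cost function. Let $v_t^\ast>0$ satisfy the transformed Hamilton--Jacobi--Bellman equation $$-\partial_t v_t^\ast = b\cdot\nabla_x v_t^\ast+\tfrac12\Sigma:D_x^2v_t^\ast-\Big(c+\tfrac12\|\sigma^{\rm T}\nabla_x\log v_t^\ast\|^2-\tfrac12\|RG^{\rm T}\nabla_x\log v_t^\ast\|_R^2\Big)v_t^\ast ,\qquad v_T^\ast=\exp(-f),$$ and let the probability densities $\bar\pi_t$ satisfy the forward evolution equation $$\partial_t\bar\pi_t=-\nabla_x\cdot(\bar\pi_t\bar b_t)-\bar\pi_t\big(\alpha_t-\bar\pi_t[\alpha_t]\big),\qquad \bar\pi_0=\delta_{x_0},$$ where $$\bar b_t(x)=b(x)-\tfrac12\big(\nabla_x\cdot\Sigma(x)+\Sigma(x)\nabla_x\log\bar\pi_t(x)\big).$$ Define $Z_t=\bar\pi_t[v_t^\ast]$, the probability density $$\tilde\pi_t:=Z_t^{-1}v_t^\ast\bar\pi_t,$$ and the modified drift $$\tilde b_t(x):=-\bar b_t(x)-\tfrac12\Sigma(x)\nabla_x\log v_t^\ast(x).$$ Then $\tilde\pi_t$ satisfies the reverse time evolution equation $$-\partial_t\tilde\pi_t=-\nabla_x\cdot(\tilde\pi_t\tilde b_t)-\tilde\pi_t\Big(c-\alpha_t+\tfrac12\|\sigma^{\rm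 T}\nabla_x\log v_t^\ast\|^2-\tfrac12\|RG^{\rm T}\nabla_x\log v_t^\ast\|_R^2-\zeta_t\Big)$$ for $t\in(0,T]$, with terminal condition $\tilde\pi_T=Z_T^{-1}\exp(-f)\,\bar\pi_T$, where $\zeta_t$ is an appropriate normalization constant (a real number depending on $t$ but not on $x$).
   Context: Setting: $b:\mathbb{R}^{d_x}\to\mathbb{R}^{d_x}$, $G:\mathbb{R}^{d_x}\to\mathbb{R}^{d_x\times d_u}$, $\sigma:\mathbb{R}^{d_x}\to\mathbb{R}^{d_x\times d_b}$ are given functions, $x_0\in\mathbb{R}^{d_x}$ is given, and $\Sigma(x)=\sigma(x)\sigma(x)^{\rm T}$. The running cost is $c(x)=\tfrac12h(x)^{\rm T}S^{-1}h(x)$ and the terminal cost is $f(x)=\tfrac12\xi(x)^{\rm T}V^{-1}\xi(x)$, for given functions $h:\mathbb{R}^{d_x}\to\mathbb{R}^{d_h}$, $\xi:\mathbb{R}^{d_x}\to\mathbb{R}^{d_\xi}$ and given symmetric positive definite matrices $S\in\mathbb{R}^{d_h\times d_h}$, $V\in\mathbb{R}^{d_\xi\times d_\xi}$. The matrix $R\in\mathbb{R}^{d_u\times d_u}$ is symmetric positive definite and $\|u\|_R^2=u^{\rm T}R^{-1}u$; $\|\cdot\|$ is the Euclidean norm. Notation: $A:B=\mathrm{tr}(AB^{\rm T})$ is the Frobenius inner product; $D_x^2$ denotes the Hessian; $(\nabla_x\cdot\Sigma)_i=\sum_j\partial_{x_j}\Sigma_{ij}$; for a density $\pi$ and a function $g$,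 $\pi[g]=\int g(x)\pi(x)\,{\rm d}x$; $\delta_{x_0}$ is the Dirac delta centered at $x_0$. Conventions: the coefficient functions and the solutions $v_t^\ast,\bar\pi_t$ are tacitly assumed to be sufficiently regular (for $t\in(0,T]$ they are positive and classical solutions, and all integrals appearing are finite) for the equations to be meaningful. The initial condition $\bar\pi_0=\delta_{x_0}$ is understood as a limit as $t\to0^+$. *)

theory Defs
  imports "HOL-Analysis.Analysis"
begin

text \<open>The dimensions are the cardinalities of finite index types, and \<^typ>\<open>real^'m^'n\<close> is the type
  of matrices with rows indexed by \<^typ>\<open>'n\<close> and columns indexed by \<^typ>\<open>'m\<close>.\<close>

subsection \<open>Matrices\<close>

definition sym_pos_def :: "real^'n^'n \<Rightarrow> bool" where
  "sym_pos_def M \<longleftrightarrow> transpose M = M \<and> (\<forall>w. w \<noteq> 0 \<longrightarrow> 0 < w \<bullet> (M *v w))"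

definition frobenius :: "real^'m^'n \<Rightarrow> real^'m^'n \<Rightarrow> real" where
  "frobenius A B = trace (A ** transpose B)"

text \<open>The squared norm weighted by the \<^emph>\<open>inverse\<close> of the given matrix.\<close>

definition wnorm_sq :: "real^'n^'n \<Rightarrow> real^'n \<Rightarrow> real" where
  "wnorm_sq M u = u \<bullet> (matrix_inv M *v u)"

definition quad_cost :: "real^'m^'m \<Rightarrow> ('a \<Rightarrow> real^'m) \<Rightarrow> 'a \<Rightarrow> real" where
  "quad_cost M g x = 1/2 * wnorm_sq M (g x)"

subsection \<open>Differential operators in the space variable\<close>

text \<open>As usual for \<^const>\<open>frechet_derivative\<close>, the values below are meaningful only at points of
  differentiability.\<close>

definition pd :: "'n \<Rightarrow> (real^'n \<Rightarrow> real) \<Rightarrow> real^'n \<Rightarrow> real" where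
  "pd i f x = frechet_derivative f (at x) (axis i 1)"

definition grad :: "(real^'n \<Rightarrow> real) \<Rightarrow> real^'n \<Rightarrow> real^'n" where
  "grad f x = (\<chi> i. pd i f x)"

definition hessian :: "(real^'n \<Rightarrow> real) \<Rightarrow> real^'n \<Rightarrow> real^'n^'n" where
  "hessian f x = (\<chi> i j. pd i (pd j f) x)"

definition divergence :: "(real^'n \<Rightarrow> real^'n) \<Rightarrow> real^'n \<Rightarrow> real" where
  "divergence F x = (\<Sum>i\<in>UNIV. pd i (\<lambda>y. F y $ i) x)"

definition matrix_divergence :: "(real^'n \<Rightarrow> real^'n^'n) \<Rightarrow> real^'n \<Rightarrow> real^'n" where
  "matrix_divergence M x = (\<chi> i. \<Sum>j\<in>UNIV. pd j (\<lambda>y. M y $ i $ j) x)"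

subsection \<open>Densities\<close>

definition prob_density :: "(real^'n \<Rightarrow> real) \<Rightarrow> bool" where
  "prob_density p \<longleftrightarrow> (\<forall>x. 0 \<le> p x) \<and> has_bochner_integral lborel p 1"

definition expect :: "(real^'n \<Rightarrow> real) \<Rightarrow> (real^'n \<Rightarrow> real) \<Rightarrow> real" where
  "expect p g = (LINT x|lborel. g x * p x)"

text \<open>Weak convergence of the measures with densities \<^term>\<open>p t\<close> to the Dirac measure at
  \<^term>\<open>z\<close> as \<^term>\<open>t\<close> decreases to 0.\<close>

definition tends_to_dirac :: "(real \<Rightarrow> real^'n \<Rightarrow> real) \<Rightarrow> real^'n \<Rightarrow> bool" where
  "tends_to_dirac p z \<longleftrightarrow>
     (\<forall>\<phi> :: real^'n \<Rightarrow> real. continuous_on UNIV \<phi> \<and> bounded (range \<phi>) \<longrightarrow>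
        ((\<lambda>t. expect (p t) \<phi>) \<longlongrightarrow> \<phi> z) (at_right 0))"

subsection \<open>The transformed control problem\<close>

definition diffusion :: "(real^'n \<Rightarrow> real^'m^'n) \<Rightarrow> real^'n \<Rightarrow> real^'n^'n" where
  "diffusion \<sigma> x = \<sigma> x ** transpose (\<sigma> x)"

definition log_grad_cost ::
  "(real^'n \<Rightarrow> real^'m^'n) \<Rightarrow> (real^'n \<Rightarrow> real^'u^'n) \<Rightarrow> real^'u^'u \<Rightarrow>
   (real^'n \<Rightarrow> real) \<Rightarrow> real^'n \<Rightarrow> real" where
  "log_grad_cost \<sigma> G R w x =
     1/2 * (norm (transpose (\<sigma> x) *v grad (\<lambda>y. ln (w y)) x))\<^sup>2
   - 1/2 * wnorm_sq R (R *v (transpose (G x) *v grad (\<lambda>y. ln (w y)) x))"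

definition drift_bar ::
  "(real^'n \<Rightarrow> real^'n) \<Rightarrow> (real^'n \<Rightarrow> real^'m^'n) \<Rightarrow> (real^'n \<Rightarrow> real) \<Rightarrow> real^'n \<Rightarrow> real^'n" where
  "drift_bar b \<sigma> p x =
     b x - (1/2) *\<^sub>R (matrix_divergence (diffusion \<sigma>) x
                     + diffusion \<sigma> x *v grad (\<lambda>y. ln (p y)) x)"

definition drift_tilde ::
  "(real^'n \<Rightarrow> real^'n) \<Rightarrow> (real^'n \<Rightarrow> real^'m^'n) \<Rightarrow> (real^'n \<Rightarrow> real) \<Rightarrow> (real^'n \<Rightarrow> real) \<Rightarrow>
   real^'n \<Rightarrow> real^'n" where
  "drift_tilde b \<sigma> p w x =
     - drift_bar b \<sigma> p x - (1/2) *\<^sub>R (diffusion \<sigma> x *v grad (\<lambda>y. ln (w y)) x)"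

definition density_tilde :: "(real^'n \<Rightarrow> real) \<Rightarrow> (real^'n \<Rightarrow> real) \<Rightarrow> real^'n \<Rightarrow> real" where
  "density_tilde p w x = inverse (expect p w) * w x * p x"

end

theory Submission
  imports Defs
begin

text \<open>
  Differentiating \<open>\<pi> = v p / Z\<close> in time and inserting the equations for \<open>v\<close> and \<open>p\<close> makes
  \<open>- \<partial>\<^sub>t \<pi>\<close> the sum of \<open>\<pi> (Z' / Z)\<close>, of the zeroth-order terms \<open>- \<pi> (c + L)\<close> and
  \<open>\<pi> (\<alpha> - p[\<alpha>])\<close>, where \<open>L\<close> is the difference of the two quadratic terms in \<open>\<nabla> log v\<close>, and of
  \<open>1 / Z\<close> times the transport terms
  \<open>v \<nabla>\<cdot>(p bbar) + p (b \<cdot> \<nabla>v + (1/2) \<Sigma> : D\<^sup>2v)\<close>.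

  The drift \<open>btilde = - bbar - (1/2) \<Sigma> \<nabla> log v\<close> is chosen so that these transport terms are exactly
  \<open>- \<nabla>\<cdot>(v p btilde)\<close>, which is the lemma \<open>divergence_scaled_drift_tilde\<close>. Since \<open>v \<nabla> log v = \<nabla>v\<close>,
  the reversed flux is \<open>- v p bbar - (1/2) p \<Sigma> \<nabla>v\<close>. The product rule gives the two cross terms
  \<open>\<nabla>v \<cdot> (p bbar)\<close> and \<open>(1/2) \<nabla>\<cdot>(p \<Sigma> \<nabla>v)\<close>. The first contains
  \<open>- (1/2) (p (\<nabla>\<cdot>\<Sigma>) \<cdot> \<nabla>v + \<nabla>v \<cdot> \<Sigma> \<nabla>p)\<close>; these are precisely the first-order terms of the
  second, with the opposite sign, because \<open>\<Sigma>\<close> is symmetric. What survives is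
  \<open>p b \<cdot> \<nabla>v + (1/2) p \<Sigma> : D\<^sup>2v\<close>, which is \<open>p\<close> times the generator of the uncontrolled
  diffusion applied to \<open>v\<close>.

  All remaining terms are multiples of \<open>\<pi>\<close>. Those whose coefficient does not depend on the space
  variable make up the normalization constant \<open>\<zeta> = Z' / Z - p[\<alpha>]\<close>.
\<close>

section \<open>Differentiation rules in coordinates\<close>

lemma pd_eqI: "(f has_derivative f') (at x) \<Longrightarrow> pd i f x = f' (axis i 1)"
  unfolding pd_def by (metis frechet_derivative_at)

lemma has_derivative_frechet:
  "f differentiable (at x) \<Longrightarrow> (f has_derivative frechet_derivative f (at x)) (at x)"
  by (simp add: frechet_derivative_works)

lemma pd_mult:
  assumes "f differentiable (at x)" "g differentiable (at x)"
  shows "pd i (\<lambda>y. f y * g y) x = f x * pd i g x + pd i f x * g x"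
  using pd_eqI[OF has_derivative_mult[OF assms[THEN has_derivative_frechet]], of i]
  by (simp add: pd_def)

lemma pd_add:
  assumes "f differentiable (at x)" "g differentiable (at x)"
  shows "pd i (\<lambda>y. f y + g y) x = pd i f x + pd i g x"
  using pd_eqI[OF has_derivative_add[OF assms[THEN has_derivative_frechet]], of i]
  by (simp add: pd_def)

lemma pd_cmult:
  assumes "f differentiable (at x)"
  shows "pd i (\<lambda>y. c * f y) x = c * pd i f x"
  using pd_eqI[OF has_derivative_mult_right[OF assms[THEN has_derivative_frechet]], of i c]
  by (simp add: pd_def)

lemma pd_sum:
  assumes "\<And>j. j \<in> A \<Longrightarrow> f j differentiable (at x)"
  shows "pd i (\<lambda>y. \<Sum>j\<in>A. f j y) x = (\<Sum>j\<in>A. pd i (f j) x)"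
  using pd_eqI[OF has_derivative_sum[of A f "\<lambda>j. frechet_derivative (f j) (at x)" "at x"], of i]
    assms
  by (simp add: pd_def has_derivative_frechet)

lemma grad_ln:
  assumes "f differentiable (at x)" "0 < f x"
  shows "grad (\<lambda>y. ln (f y)) x = inverse (f x) *\<^sub>R grad f x"
  using pd_eqI[OF has_derivative_ln[OF assms(2) has_derivative_frechet[OF assms(1)]]]
  by (simp add: grad_def pd_def vec_eq_iff)

lemma differentiable_vec_nth:
  "F differentiable (at x) \<Longrightarrow> (\<lambda>y. F y $ i) differentiable (at x)"
  unfolding differentiable_def
  using bounded_linear.has_derivative[OF bounded_linear_vec_nth] by blast

lemma differentiable_matrix_vector_mult:
  fixes M :: "'a::real_normed_vector \<Rightarrow> real^'m^'k" and F :: "'a \<Rightarrow> real^'m"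
  assumes "M differentiable (at x)" "F differentiable (at x)"
  shows "(\<lambda>y. M y *v F y) differentiable (at x)"
proof -
  have "bounded_bilinear ((*v) :: real^'m^'k \<Rightarrow> real^'m \<Rightarrow> real^'k)"
    by (simp add: bilinear_conv_bounded_bilinear[symmetric] bilinear_def linear_iff
        matrix_vector_mult_add_rdistrib matrix_vector_right_distrib
        scaleR_matrix_vector_assoc matrix_vector_mult_scaleR)
  from bounded_bilinear.FDERIV[OF this assms[THEN has_derivative_frechet]]
  show ?thesis unfolding differentiable_def by blast
qed

lemma divergence_add:
  assumes "F differentiable (at x)" "H differentiable (at x)"
  shows "divergence (\<lambda>y. F y + H y) x = divergence F x + divergence H x"
  by (simp add: divergence_def pd_add differentiable_vec_nth assms sum.distrib)

lemma divergence_cmult: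
  assumes "F differentiable (at x)"
  shows "divergence (\<lambda>y. c *\<^sub>R F y) x = c * divergence F x"
  by (simp add: divergence_def pd_cmult differentiable_vec_nth assms sum_distrib_left)

lemma divergence_scaleR:
  assumes "f differentiable (at x)" "F differentiable (at x)"
  shows "divergence (\<lambda>y. f y *\<^sub>R F y) x = grad f x \<bullet> F x + f x * divergence F x"
  by (simp add: divergence_def pd_mult differentiable_vec_nth assms sum.distrib
      sum_distrib_left grad_def inner_vec_def)

lemma symmetric_matrix_inner:
  fixes A :: "real^'n^'n"
  assumes "transpose A = A"
  shows "u \<bullet> (A *v w) = w \<bullet> (A *v u)"
  by (metis assms dot_lmul_matrix inner_commute transpose_matrix_vector)

lemma frobenius_eq_sum: "frobenius A B = (\<Sum>i\<in>UNIV. \<Sum>j\<in>UNIV. A $ i $ j * B $ i $ j)"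
  by (simp add: frobenius_def trace_def matrix_matrix_mult_def transpose_def)

text \<open>The divergence \<^const>\<open>matrix_divergence\<close> acts on rows, whereas the product rule produces the
  divergence of the columns of \<open>M\<close>; symmetry identifies the two.\<close>

lemma divergence_matrix_grad:
  assumes M: "M differentiable (at x)" and w: "grad w differentiable (at x)"
    and sym: "\<And>y. transpose (M y) = M y"
  shows "divergence (\<lambda>y. M y *v grad w y) x
    = matrix_divergence M x \<bullet> grad w x + frobenius (M x) (hessian w x)"
proof -
  have dw: "pd j w differentiable (at x)" for j
    using differentiable_vec_nth[OF w, of j] by (simp add: grad_def)
  have dM: "(\<lambda>y. M y $ i $ j) differentiable (at x)" for i j
    by (intro differentiable_vec_nth M)
  have sym': "M y $ i $ j = M y $ j $ i" for y i j
    by (metis (no_types, lifting) sym transpose_def vec_lambda_beta)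
  have "divergence (\<lambda>y. M y *v grad w y) x
      = (\<Sum>i\<in>UNIV. \<Sum>j\<in>UNIV. pd i (\<lambda>y. M y $ i $ j * pd j w y) x)"
    by (simp add: divergence_def matrix_vector_mult_def grad_def pd_sum dM dw)
  also have "\<dots> = (\<Sum>i\<in>UNIV. \<Sum>j\<in>UNIV. pd i (\<lambda>y. M y $ i $ j) x * pd j w x)
      + frobenius (M x) (hessian w x)"
    by (simp add: pd_mult dM dw sum.distrib frobenius_eq_sum hessian_def)
  also have "(\<Sum>i\<in>UNIV. \<Sum>j\<in>UNIV. pd i (\<lambda>y. M y $ i $ j) x * pd j w x)
      = (\<Sum>j\<in>UNIV. \<Sum>i\<in>UNIV. pd i (\<lambda>y. M y $ j $ i) x * pd j w x)"
    by (subst sum.swap) (simp add: sym'[of _ _ _])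
  also have "\<dots> = matrix_divergence M x \<bullet> grad w x"
    by (simp add: matrix_divergence_def grad_def inner_vec_def sum_distrib_right)
  finally show ?thesis .
qed

section \<open>The reversed flux\<close>

lemma transpose_diffusion: "transpose (diffusion \<sigma> x) = diffusion \<sigma> x"
  by (simp add: diffusion_def matrix_transpose_mul)

text \<open>Multiplied by the density, the logarithmic gradient in the drift becomes \<^term>\<open>grad p\<close>. In this
  form the probability flux is visibly a differentiable function of space.\<close>

lemma scaled_drift_bar:
  assumes "p differentiable (at x)" "0 < p x"
  shows "p x *\<^sub>R drift_bar b \<sigma> p x = p x *\<^sub>R b x
    - (1/2) *\<^sub>R (p x *\<^sub>R matrix_divergence (diffusion \<sigma>) x + diffusion \<sigma> x *v grad p x)"
  using assms(2)
  by (simp add: drift_bar_def grad_ln[OF assms] matrix_vector_mult_scaleR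
      scaleR_right_diff_distrib scaleR_right_distrib)

context
  fixes b :: "real^'n \<Rightarrow> real^'n" and \<sigma> :: "real^'n \<Rightarrow> real^'m^'n"
    and p w :: "real^'n \<Rightarrow> real"
  assumes coeff: "\<And>x. b differentiable (at x)" "\<And>x. diffusion \<sigma> differentiable (at x)"
      "\<And>x. matrix_divergence (diffusion \<sigma>) differentiable (at x)"
    and p: "\<And>x. 0 < p x" "\<And>x. p differentiable (at x)" "\<And>x. grad p differentiable (at x)"
    and w: "\<And>x. 0 < w x" "\<And>x. w differentiable (at x)" "\<And>x. grad w differentiable (at x)"
begin

lemma scaled_drift_bar_differentiable: "(\<lambda>y. p y *\<^sub>R drift_bar b \<sigma> p y) differentiable (at x)"
  unfolding scaled_drift_bar[OF p(2,1)]
  by (intro differentiable_diff differentiable_add differentiable_scaleR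
      differentiable_matrix_vector_mult differentiable_const coeff p)

lemma scaled_drift_tilde:
  "(w x * p x) *\<^sub>R drift_tilde b \<sigma> p w x
    = - (w x *\<^sub>R (p x *\<^sub>R drift_bar b \<sigma> p x) + (1/2) *\<^sub>R (p x *\<^sub>R (diffusion \<sigma> x *v grad w x)))"
  using w(1)[of x]
  by (simp add: drift_tilde_def grad_ln[OF w(2,1)] matrix_vector_mult_scaleR
      scaleR_right_diff_distrib scaleR_right_distrib)

lemma scaled_drift_tilde_differentiable:
  "(\<lambda>y. (w y * p y) *\<^sub>R drift_tilde b \<sigma> p w y) differentiable (at x)"
  unfolding scaled_drift_tilde
  by (intro differentiable_minus differentiable_add differentiable_scaleR
      differentiable_matrix_vector_mult differentiable_const coeff p w
      scaled_drift_bar_differentiable)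

text \<open>The first-order terms in \<open>\<nabla>\<cdot>(p \<Sigma> \<nabla>w)\<close> cancel against the diffusive part of
  \<open>\<nabla>w \<cdot> (p bbar)\<close>, by the symmetry of \<open>\<Sigma>\<close>. Reversing the flux thus turns the backward generator
  acting on \<open>w\<close> into a divergence.\<close>

lemma divergence_scaled_drift_tilde:
  "- divergence (\<lambda>y. (w y * p y) *\<^sub>R drift_tilde b \<sigma> p w y) x
    = w x * divergence (\<lambda>y. p y *\<^sub>R drift_bar b \<sigma> p y) x
      + p x * (b x \<bullet> grad w x + 1/2 * frobenius (diffusion \<sigma> x) (hessian w x))"
proof -
  define F where "F = (\<lambda>y. p y *\<^sub>R drift_bar b \<sigma> p y)"
  define H where "H = (\<lambda>y. diffusion \<sigma> y *v grad w y)"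
  have dF: "F differentiable (at x)"
    unfolding F_def by (rule scaled_drift_bar_differentiable)
  have dH: "H differentiable (at x)"
    unfolding H_def by (intro differentiable_matrix_vector_mult coeff w)
  have "divergence (\<lambda>y. (w y * p y) *\<^sub>R drift_tilde b \<sigma> p w y) x
      = divergence (\<lambda>y. (-1) *\<^sub>R (w y *\<^sub>R F y + (1/2) *\<^sub>R (p y *\<^sub>R H y))) x"
    unfolding scaled_drift_tilde F_def H_def by simp
  also have "\<dots> = - (divergence (\<lambda>y. w y *\<^sub>R F y) x + 1/2 * divergence (\<lambda>y. p y *\<^sub>R H y) x)"
    using dF dH w p
    by (simp only: divergence_cmult divergence_add differentiable_scaleR differentiable_add
        differentiable_const) simp
  also have "divergence (\<lambda>y. w y *\<^sub>R F y) x = grad w x \<bullet> F x + w x * divergence F x"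
    by (intro divergence_scaleR dF w)
  also have "divergence (\<lambda>y. p y *\<^sub>R H y) x = grad p x \<bullet> H x + p x * divergence H x"
    by (intro divergence_scaleR dH p)
  also have "divergence H x = matrix_divergence (diffusion \<sigma>) x \<bullet> grad w x
      + frobenius (diffusion \<sigma> x) (hessian w x)"
    unfolding H_def by (intro divergence_matrix_grad coeff w transpose_diffusion)
  also have "grad p x \<bullet> H x = grad w x \<bullet> (diffusion \<sigma> x *v grad p x)"
    unfolding H_def by (rule symmetric_matrix_inner[OF transpose_diffusion])
  also have "grad w x \<bullet> F x = p x * (b x \<bullet> grad w x)
      - 1/2 * (p x * (matrix_divergence (diffusion \<sigma>) x \<bullet> grad w x)
        + grad w x \<bullet> (diffusion \<sigma> x *v grad p x))"
    unfolding F_def scaled_drift_bar[OF p(2,1)]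
    by (simp add: inner_diff_right inner_add_right inner_commute)
  finally show ?thesis
    unfolding F_def by (simp add: algebra_simps)
qed

end

section \<open>Normalization\<close>

text \<open>An integrable function with vanishing integral that is positive everywhere would make the whole
  space a null set.\<close>

lemma expect_pos:
  assumes "integrable lborel (\<lambda>x. w x * p x)" "\<And>x. 0 < p x" "\<And>x. 0 < w x"
  shows "0 < expect p w"
proof -
  have "expect p w \<noteq> 0"
  proof
    assume "expect p w = 0"
    then have "AE x in lborel. w x * p x = 0"
      using integral_nonneg_eq_0_iff_AE[OF assms(1)] assms(2,3)
      by (simp add: expect_def less_imp_le)
    moreover have "w x * p x \<noteq> 0" for x
      using assms(2,3)[of x] by simp
    ultimately have "AE x::real^'a in lborel. False"
      by simp
    then show False
      by (simp add: AE_iff_null null_sets_def)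
  qed
  moreover have "0 \<le> expect p w"
    unfolding expect_def using assms(2,3) by (simp add: less_imp_le)
  ultimately show ?thesis by simp
qed

lemma prob_density_tilde:
  assumes "integrable lborel (\<lambda>x. w x * p x)" "\<And>x. 0 < p x" "\<And>x. 0 < w x"
  shows "prob_density (density_tilde p w)"
proof -
  note Z = expect_pos[OF assms]
  have "has_bochner_integral lborel (\<lambda>x. inverse (expect p w) * (w x * p x))
      (inverse (expect p w) * expect p w)"
    unfolding expect_def
    by (intro has_bochner_integral_mult_right has_bochner_integral_integrable assms(1))
  then show ?thesis
    using Z assms(2,3)
    by (simp add: prob_density_def density_tilde_def[abs_def] mult.assoc less_imp_le)
qed

theorem lemma3p1:
  fixes b :: "real^'x \<Rightarrow> real^'x"
    and G :: "real^'x \<Rightarrow> real^'u^'x"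
    and \<sigma> :: "real^'x \<Rightarrow> real^'b^'x"
    and R :: "real^'u^'u"
    and S :: "real^'h^'h" and h :: "real^'x \<Rightarrow> real^'h"
    and V :: "real^'k^'k" and \<xi> :: "real^'x \<Rightarrow> real^'k"
    and x0 :: "real^'x" and T :: real
    and \<alpha> v p :: "real \<Rightarrow> real^'x \<Rightarrow> real"
  assumes T_pos: "0 < T"
    and spd: "sym_pos_def R" "sym_pos_def S" "sym_pos_def V"
    and alpha_convex: "\<And>t. t \<in> {0..T} \<Longrightarrow> convex_on UNIV (\<alpha> t)"
    and coeff_regular:
      "\<And>x. b differentiable (at x)"
      "\<And>x. diffusion \<sigma> differentiable (at x)"
      "\<And>x. matrix_divergence (diffusion \<sigma>) differentiable (at x)"
    and v_pos: "\<And>t x. t \<in> {0<..T} \<Longrightarrow> 0 < v t x"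
    and v_regular:
      "\<And>t x. t \<in> {0<..T} \<Longrightarrow> v t differentiable (at x)"
      "\<And>t x. t \<in> {0<..T} \<Longrightarrow> grad (v t) differentiable (at x)"
    and v_equation: "\<And>t x. t \<in> {0<..T} \<Longrightarrow>
      ((\<lambda>s. v s x) has_real_derivative
        - (b x \<bullet> grad (v t) x + 1/2 * frobenius (diffusion \<sigma> x) (hessian (v t) x)
           - (quad_cost S h x + log_grad_cost \<sigma> G R (v t) x) * v t x))
      (at t within {0<..T})"
    and v_terminal: "\<And>x. v T x = exp (- quad_cost V \<xi> x)"
    and p_density: "\<And>t. t \<in> {0<..T} \<Longrightarrow> prob_density (p t)"
    and p_pos: "\<And>t x. t \<in> {0<..T} \<Longrightarrow> 0 < p t x"
    and p_regular:
      "\<And>t x. t \<in> {0<..T} \<Longrightarrow> p t differentiable (at x)"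
      "\<And>t x. t \<in> {0<..T} \<Longrightarrow> grad (p t) differentiable (at x)"
    and p_equation: "\<And>t x. t \<in> {0<..T} \<Longrightarrow>
      ((\<lambda>s. p s x) has_real_derivative
        (- divergence (\<lambda>y. p t y *\<^sub>R drift_bar b \<sigma> (p t) y) x
         - p t x * (\<alpha> t x - expect (p t) (\<alpha> t))))
      (at t within {0<..T})"
    and p_initial: "tends_to_dirac p x0"
    and alpha_integrable: "\<And>t. t \<in> {0<..T} \<Longrightarrow> integrable lborel (\<lambda>x. \<alpha> t x * p t x)"
    and v_integrable: "\<And>t. t \<in> {0<..T} \<Longrightarrow> integrable lborel (\<lambda>x. v t x * p t x)"
    and Z_differentiable: "\<And>t. t \<in> {0<..T} \<Longrightarrow>
      (\<lambda>s. expect (p s) (v s)) differentiable (at t within {0<..T})"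
  shows "(\<forall>t\<in>{0<..T}. prob_density (density_tilde (p t) (v t))) \<and>
    (\<exists>\<zeta> :: real \<Rightarrow> real. \<forall>t\<in>{0<..T}. \<forall>x.
       (\<lambda>y. density_tilde (p t) (v t) y *\<^sub>R drift_tilde b \<sigma> (p t) (v t) y)
          differentiable (at x) \<and>
       ((\<lambda>s. density_tilde (p s) (v s) x) has_real_derivative
          - (- divergence
                (\<lambda>y. density_tilde (p t) (v t) y *\<^sub>R drift_tilde b \<sigma> (p t) (v t) y) x
             - density_tilde (p t) (v t) x *
                (quad_cost S h x - \<alpha> t x + log_grad_cost \<sigma> G R (v t) x - \<zeta> t)))
       (at t within {0<..T})) \<and>
    (\<forall>x. density_tilde (p T) (v T) x =
       inverse (expect (p T) (v T)) * exp (- quad_cost V \<xi> x) * p T x)"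
proof (intro conjI)
  define Z where "Z s = expect (p s) (v s)" for s
  have Z_pos: "0 < Z t" if "t \<in> {0<..T}" for t
    unfolding Z_def using that by (intro expect_pos v_integrable p_pos v_pos)
  have "\<exists>D. (Z has_real_derivative D) (at t within {0<..T})" if "t \<in> {0<..T}" for t
    using Z_differentiable[OF that] unfolding Z_def by (simp add: real_differentiable_def)
  then obtain Z' where Z': "\<And>t. t \<in> {0<..T} \<Longrightarrow> (Z has_real_derivative Z' t) (at t within {0<..T})"
    by metis
  \<comment> \<open>The first term comes from differentiating \<^term>\<open>inverse (Z s)\<close>, the second is the mean
    subtracted in the equation for \<^term>\<open>p\<close>.\<close>
  define \<zeta> where "\<zeta> t = Z' t / Z t - expect (p t) (\<alpha> t)" for t
  show "\<forall>t\<in>{0<..T}. prob_density (density_tilde (p t) (v t))"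
    by (intro ballI prob_density_tilde v_integrable p_pos v_pos)
  show "\<forall>x. density_tilde (p T) (v T) x =
       inverse (expect (p T) (v T)) * exp (- quad_cost V \<xi> x) * p T x"
    by (simp add: density_tilde_def v_terminal)
  show "\<exists>\<zeta> :: real \<Rightarrow> real. \<forall>t\<in>{0<..T}. \<forall>x.
       (\<lambda>y. density_tilde (p t) (v t) y *\<^sub>R drift_tilde b \<sigma> (p t) (v t) y)
          differentiable (at x) \<and>
       ((\<lambda>s. density_tilde (p s) (v s) x) has_real_derivative
          - (- divergence
                (\<lambda>y. density_tilde (p t) (v t) y *\<^sub>R drift_tilde b \<sigma> (p t) (v t) y) x
             - density_tilde (p t) (v t) x *
                (quad_cost S h x - \<alpha> t x + log_grad_cost \<sigma> G R (v t) x - \<zeta> t)))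
       (at t within {0<..T})"
  proof (rule exI[of _ \<zeta>], intro ballI allI conjI)
    fix t x
    assume t: "t \<in> {0<..T}"
    let ?J = "\<lambda>y. (v t y * p t y) *\<^sub>R drift_tilde b \<sigma> (p t) (v t) y"
    have J: "(\<lambda>y. density_tilde (p t) (v t) y *\<^sub>R drift_tilde b \<sigma> (p t) (v t) y)
        = (\<lambda>y. inverse (Z t) *\<^sub>R ?J y)"
      by (simp add: density_tilde_def Z_def mult.assoc)
    have dJ: "?J differentiable (at x)"
      by (intro scaled_drift_tilde_differentiable coeff_regular p_pos p_regular v_pos v_regular t)
    then show "(\<lambda>y. density_tilde (p t) (v t) y *\<^sub>R drift_tilde b \<sigma> (p t) (v t) y)
        differentiable (at x)"
      unfolding J by (intro differentiable_scaleR[OF differentiable_const])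
    have div: "divergence (\<lambda>y. density_tilde (p t) (v t) y *\<^sub>R drift_tilde b \<sigma> (p t) (v t) y) x
        = - (inverse (Z t) * (v t x * divergence (\<lambda>y. p t y *\<^sub>R drift_bar b \<sigma> (p t) y) x
          + p t x * (b x \<bullet> grad (v t) x
              + 1/2 * frobenius (diffusion \<sigma> x) (hessian (v t) x))))"
      unfolding J divergence_cmult[OF dJ]
      by (subst divergence_scaled_drift_tilde[symmetric])
        (use coeff_regular p_pos p_regular v_pos v_regular t in auto)
    have "((\<lambda>s. inverse (Z s) * v s x * p s x) has_real_derivative
        - (- divergence
              (\<lambda>y. density_tilde (p t) (v t) y *\<^sub>R drift_tilde b \<sigma> (p t) (v t) y) x
           - density_tilde (p t) (v t) x *
              (quad_cost S h x - \<alpha> t x + log_grad_cost \<sigma> G R (v t) x - \<zeta> t)))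
        (at t within {0<..T})"
      unfolding div
      using Z_pos[OF t]
      by (auto intro!: derivative_eq_intros Z'[OF t] v_equation[OF t] p_equation[OF t]
          simp: density_tilde_def \<zeta>_def Z_def[symmetric] field_simps)
    then show "((\<lambda>s. density_tilde (p s) (v s) x) has_real_derivative
        - (- divergence
              (\<lambda>y. density_tilde (p t) (v t) y *\<^sub>R drift_tilde b \<sigma> (p t) (v t) y) x
           - density_tilde (p t) (v t) x *
              (quad_cost S h x - \<alpha> t x + log_grad_cost \<sigma> G R (v t) x - \<zeta> t)))
        (at t within {0<..T})"
      by (simp add: density_tilde_def Z_def)
  qed
qed

end
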